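(* Let $f\in\mathcal{H}$ be such that $zf'(z)/f(z)$ is analytic in $\mathbb{D}$, and let $\beta$ be a real number. If either of the following holds, then $f\in\mathcal{S}^*_e$: (a) $\dfrac{zf'(z)}{f(z)}+\beta\dfrac{zf'(z)}{f(z)}\left(1-\dfrac{zf'(z)}{f(z)}+\dfrac{zf''(z)}{f'(z)}\right)\prec\dfrac{2+2z}{2-z}$ and $\beta\ge\dfrac{e+2-\sqrt2(e-1)}{e(\sqrt2-1)}$; (b) $\dfrac{zf'(z)}{f(z)}+\beta\left(1-\dfrac{zf'(z)}{f(z)}+\dfrac{zf''(z)}{f'(z)}\right)\prec\dfrac{2+2z}{2-z}$ and $\beta\ge\dfrac{e+2-\sqrt2(e-1)}{\sqrt2-1}$.
   Context: $\mathbb{D}=\{z\in\mathbb{C}:|z|<1\}$. $\mathcal{H}$ is the class of analytic functions $f$ on $\mathbb{D}$ with $f(0)=0$ and $f'(0)=1$. For functions $F,G$ analytic in $\mathbb{D}$, $F\prec G$ means there is an analytic $w:\mathbb{D}\to\mathbb{C}$ with $w(0)=0$, $|w(z)|<1$ and $F(z)=G(w(z))$ for all $z\in\mathbb{D}$; writing $F\prec G$ presupposes that $F$ and $G$ are analytic in $\mathbb{D}$ (removable singularities being filled in; in particular $zf'(z)/f(z)$ takes the value $1$ at $z=0$). $\mathcal{S}^*_e$ is the class of $f\in\mathcal{H}$ with $zf'(z)/f(z)\prec e^z$. *)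

theory Defs
  imports "HOL-Complex_Analysis.Complex_Analysis"
begin

abbreviation unit_disc :: "complex set" where
  "unit_disc \<equiv> ball 0 1"

text \<open>Functions on the disc are total functions on \<^typ>\<open>complex\<close>; their values outside the
  disc are irrelevant.\<close>

definition normalized_analytic :: "(complex \<Rightarrow> complex) set" where
  "normalized_analytic = {f. f holomorphic_on unit_disc \<and> f 0 = 0 \<and> deriv f 0 = 1}"

definition subordinate :: "(complex \<Rightarrow> complex) \<Rightarrow> (complex \<Rightarrow> complex) \<Rightarrow> bool"
    (infix "\<prec>\<^sub>s" 50) where
  "F \<prec>\<^sub>s G \<longleftrightarrow>
     F holomorphic_on unit_disc \<and> G holomorphic_on unit_disc \<and>
     (\<exists>w. w holomorphic_on unit_disc \<and> w 0 = 0 \<and>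
          (\<forall>z\<in>unit_disc. norm (w z) < 1 \<and> F z = G (w z)))"

text \<open>Quotients are totalized by \<open>x / 0 = 0\<close>, so the expressions below carry spurious values at
  the zeros of \<open>f\<close> and of its derivative. \<^const>\<open>remove_sings\<close> replaces the value at each point
  by the limit there, which fills in the removable singularities. At a pole it returns \<open>0\<close>, and the
  resulting function is discontinuous there, so holomorphy of the filled-in function still says that
  every singularity of the expression is removable.\<close>

definition log_deriv_quot :: "(complex \<Rightarrow> complex) \<Rightarrow> complex \<Rightarrow> complex" where
  "log_deriv_quot f = remove_sings (\<lambda>z. z * deriv f z / f z)"

definition starlike_exp :: "(complex \<Rightarrow> complex) set" where
  "starlike_exp = {f \<in> normalized_analytic. log_deriv_quot f \<prec>\<^sub>s exp}"

end

theory Submission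
  imports Defs
begin

text \<open>Let \<open>p = z f' / f\<close>, so that \<open>1 - p + z f'' / f' = z p' / p\<close>.  If \<open>p\<close> leaves the image of
  the disc under \<open>exp\<close>, then at a point \<open>z\<^sub>0\<close> of least modulus where it does so one has
  \<open>p z\<^sub>0 = exp \<zeta>\<close> with \<open>|\<zeta>| = 1\<close>, and Jack's lemma for \<open>Ln \<circ> p\<close> gives \<open>z\<^sub>0 p'(z\<^sub>0) / p(z\<^sub>0) = m \<zeta>\<close>
  with \<open>m \<ge> 1\<close>.  Hence the left-hand side of the subordination equals \<open>exp \<zeta> (1 + \<beta> m \<zeta>)\<close> in (a)
  and \<open>exp \<zeta> + \<beta> m \<zeta>\<close> in (b) at \<open>z\<^sub>0\<close>.  The right-hand side maps the disc onto \<open>|W - 2| < 2\<close>, and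
  the bounds on \<open>\<beta>\<close>, of which only \<open>\<beta> \<ge> 2\<close> and \<open>\<beta> \<ge> 11 / 2\<close> are needed, keep these values out of
  that disc.\<close>

section \<open>Lower bounds on the unit circle\<close>

text \<open>For W = X + iY, |W - 2| \<ge> 2 amounts to 4X \<le> |W|^2. Here both sides carry a
  factor \<open>exp c\<close>. Once it is cancelled, the case 0 \<le> c follows from
  \<open>exp c\<close> \<ge> 1 + c, and for c < 0 the left side is not positive.\<close>

lemma norm_exp_mult_one_plus_minus_two_ge:
  fixes \<zeta> :: complex and k :: real
  assumes \<zeta>: "norm \<zeta> = 1" and k: "2 \<le> k"
  shows "2 \<le> norm (exp \<zeta> * (1 + of_real k * \<zeta>) - 2)"
proof -
  define c s where "c = Re \<zeta>" and "s = Im \<zeta>"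
  define X Y where "X = Re (exp \<zeta> * (1 + of_real k * \<zeta>))" and "Y = Im (exp \<zeta> * (1 + of_real k * \<zeta>))"
  have cs: "c\<^sup>2 + s\<^sup>2 = 1"
    using \<zeta> by (simp add: c_def s_def cmod_def)
  have c: "\<bar>c\<bar> \<le> 1" and s: "\<bar>s\<bar> \<le> 1"
    using abs_Re_le_cmod[of \<zeta>] abs_Im_le_cmod[of \<zeta>] \<zeta> by (simp_all add: c_def s_def)
  have "X\<^sup>2 + Y\<^sup>2 = (norm (exp \<zeta>))\<^sup>2 * (norm (1 + of_real k * \<zeta>))\<^sup>2"
    unfolding X_def Y_def cmod_power2[symmetric] norm_mult power_mult_distrib ..
  also have "\<dots> = (exp c)\<^sup>2 * ((1 + k * c)\<^sup>2 + (k * s)\<^sup>2)"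
    by (simp add: cmod_power2[of "1 + _"] c_def s_def)
  also have "(1 + k * c)\<^sup>2 + (k * s)\<^sup>2 = 1 + 2 * k * c + k\<^sup>2"
    using cs by algebra
  finally have XY: "X\<^sup>2 + Y\<^sup>2 = (exp c)\<^sup>2 * (1 + 2 * k * c + k\<^sup>2)" .
  have X: "X = exp c * (cos s * (1 + k * c) - k * (s * sin s))"
    by (simp add: X_def c_def s_def Re_exp Im_exp algebra_simps)
  have cos: "0 \<le> cos s"
    using s pi_gt3 by (intro cos_ge_zero) auto
  have ssin: "0 \<le> s * sin s"
    using s pi_gt3 sin_ge_zero[of s] sin_ge_zero[of "-s"]
    by (cases "0 \<le> s") (auto intro: mult_nonneg_nonneg mult_nonpos_nonpos)
  \<comment> \<open>On the unit circle |k + \<zeta>| = |1 + k \<zeta>|, so the factor 1 + 2kc + k^2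
    is a square norm.\<close>
  have "0 \<le> (k + c)\<^sup>2 + s\<^sup>2"
    by simp
  also have "\<dots> = 1 + 2 * k * c + k\<^sup>2"
    using cs by algebra
  finally have q0: "0 \<le> 1 + 2 * k * c + k\<^sup>2" .
  have "4 * (cos s * (1 + k * c) - k * (s * sin s)) \<le> exp c * (1 + 2 * k * c + k\<^sup>2)"
  proof (cases "0 \<le> c")
    case True
    have "4 * (cos s * (1 + k * c) - k * (s * sin s)) \<le> 4 * (1 * (1 + k * c) - 0)"
      using True k ssin by (intro mult_left_mono diff_mono mult_right_mono) auto
    also have "\<dots> \<le> (1 + c) * (1 + 2 * k * c + k\<^sup>2)"
    proof -
      \<comment> \<open>This is the difference of the two sides; k \<ge> 2 makes its constant term
        k^2 - 3 positive.\<close>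
      have "0 \<le> c * (k - 1)\<^sup>2 + 2 * k * c\<^sup>2 + (k\<^sup>2 - 3)"
        using True k mult_mono[of 2 k 2 k] by (intro add_nonneg_nonneg mult_nonneg_nonneg) (auto simp: power2_eq_square)
      moreover have "(1 + c) * (1 + 2 * k * c + k\<^sup>2) - 4 * (1 * (1 + k * c) - 0) = c * (k - 1)\<^sup>2 + 2 * k * c\<^sup>2 + (k\<^sup>2 - 3)"
        by (simp add: power2_eq_square algebra_simps)
      ultimately show ?thesis by linarith
    qed
    also have "\<dots> \<le> exp c * (1 + 2 * k * c + k\<^sup>2)"
      using q0 by (intro mult_right_mono exp_ge_add_one_self)
    finally show ?thesis .
  next
    case False
    have npos: "cos s * (1 + k * c) - k * (s * sin s) \<le> 0"
    proof (cases "1 + k * c \<le> 0")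
      case True
      then show ?thesis
        using mult_nonneg_nonpos[OF cos True] mult_nonneg_nonneg[OF _ ssin, of k] k by simp
    next
      case *: False
      \<comment> \<open>Since 1 + kc > 0 and k \<ge> 2, |c| < 1/2, so s^2 > 3/4. Hence |s| \<ge> 0.8
        > pi/4, where sine dominates cosine, and k|s| \<ge> 1.\<close>
      have "2 * (-c) \<le> k * (-c)"
        using False k by (intro mult_right_mono) auto
      then have "-c \<le> 1 / 2"
        using * by simp
      then have "(-c)\<^sup>2 \<le> (1 / 2)\<^sup>2"
        using False by (intro power_mono) auto
      then have "(8 / 10)\<^sup>2 \<le> \<bar>s\<bar>\<^sup>2"
        using cs by (simp add: power2_eq_square)
      then have s8: "8 / 10 \<le> \<bar>s\<bar>"
        by (rule power2_le_imp_le) simp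
      have "cos s = sin (pi / 2 - \<bar>s\<bar>)"
        by (simp add: sin_diff)
      also have "\<dots> \<le> sin \<bar>s\<bar>"
        using s8 s pi_gt3 pi_approx by (intro sin_monotone_2pi_le) auto
      finally have "cos s \<le> sin \<bar>s\<bar>" .
      have "cos s * (1 + k * c) \<le> cos s * 1"
        using False k cos by (intro mult_left_mono) (auto simp: mult_nonneg_nonpos)
      also have "\<dots> \<le> (k * \<bar>s\<bar>) * sin \<bar>s\<bar>"
        using mult_mono[of 1 "k * \<bar>s\<bar>" "cos s" "sin \<bar>s\<bar>"] mult_mono[of 2 k "8/10" "\<bar>s\<bar>"]
          \<open>cos s \<le> sin \<bar>s\<bar>\<close> cos k s8 by simp
      also have "\<dots> = k * (s * sin s)"
        by (simp add: abs_if)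
      finally show ?thesis by simp
    qed
    show ?thesis
      by (rule order_trans[OF mult_nonneg_nonpos[OF _ npos] mult_nonneg_nonneg[OF exp_ge_zero q0]]) simp
  qed
  then have "exp c * (4 * (cos s * (1 + k * c) - k * (s * sin s))) \<le> exp c * (exp c * (1 + 2 * k * c + k\<^sup>2))"
    by simp
  then have "4 * X \<le> X\<^sup>2 + Y\<^sup>2"
    unfolding XY by (simp add: X power2_eq_square mult.assoc mult.left_commute)
  then have "2\<^sup>2 \<le> (norm (exp \<zeta> * (1 + of_real k * \<zeta>) - 2))\<^sup>2"
    unfolding cmod_power2 minus_complex.sel X_def[symmetric] Y_def[symmetric]
    by (simp add: power2_eq_square algebra_simps)
  then show ?thesis
    by (rule power2_le_imp_le) simp
qed

text \<open>The term k \<zeta> has modulus at least 11/2, while |exp \<zeta> - 2| \<le> 7/2: because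
  cos s \<ge> 0, its square is at most e^2 + 4 < 49/4. The triangle inequality leaves 2.\<close>

lemma norm_exp_plus_minus_two_ge:
  fixes \<zeta> :: complex and k :: real
  assumes \<zeta>: "norm \<zeta> = 1" and k: "11 / 2 \<le> k"
  shows "2 \<le> norm (exp \<zeta> + of_real k * \<zeta> - 2)"
proof -
  define c s where "c = Re \<zeta>" and "s = Im \<zeta>"
  have c: "\<bar>c\<bar> \<le> 1" and s: "\<bar>s\<bar> \<le> 1"
    using abs_Re_le_cmod[of \<zeta>] abs_Im_le_cmod[of \<zeta>] \<zeta> by (simp_all add: c_def s_def)
  have cos: "0 \<le> cos s"
    using s pi_gt3 by (intro cos_ge_zero) auto
  have "exp c \<le> exp 1"
    using c by simp
  then have e: "exp c \<le> 272 / 100"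
    using e_less_272 by linarith
  have "(norm (exp \<zeta> - 2))\<^sup>2 = (exp c * cos s - 2)\<^sup>2 + (exp c * sin s)\<^sup>2"
    unfolding cmod_power2 by (simp add: Re_exp Im_exp c_def s_def)
  also have "\<dots> = (exp c)\<^sup>2 - 4 * (exp c * cos s) + 4"
    using sin_cos_squared_add[of s] by algebra
  also have "\<dots> \<le> (272 / 100)\<^sup>2 + 4"
    using power_mono[OF e exp_ge_zero, of 2] mult_nonneg_nonneg[OF exp_ge_zero cos, of c] by linarith
  also have "\<dots> \<le> (7 / 2)\<^sup>2"
    by (simp add: power2_eq_square)
  finally have "norm (exp \<zeta> - 2) \<le> 7 / 2"
    by (rule power2_le_imp_le) simp
  moreover have "norm (of_real k * \<zeta>) = k"
    using \<zeta> k by (simp add: norm_mult)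
  ultimately show ?thesis
    using norm_triangle_ineq4[of "exp \<zeta> + of_real k * \<zeta> - 2" "exp \<zeta> - 2"] k by simp
qed

section \<open>Numerical bounds for the thresholds on \<beta>\<close>

text \<open>The threshold equals (4 + 3 sqrt 2)/e - 1, about 2.03. Clearing denominators leaves
  3e(sqrt 2 - 1) \<le> 2 + sqrt 2; the margin is small, hence the sharp decimal bounds on e and sqrt
  2.\<close>

lemma two_le_exp_mult_bound:
  "(2::real) \<le> (exp 1 + 2 - sqrt 2 * (exp 1 - 1)) / (exp 1 * (sqrt 2 - 1))"
proof -
  have q: "(141 / 100 :: real) \<le> sqrt 2"
    by (rule real_le_rsqrt) (simp add: power2_eq_square)
  have q': "sqrt 2 \<le> (1415 / 1000 :: real)"
    by (rule real_le_lsqrt) (simp_all add: power2_eq_square)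
  have "(3 * exp 1) * sqrt 2 \<le> 3 * exp 1 + 2 + sqrt (2::real)"
  proof -
    have "exp 1 * (3 * sqrt 2 - 3) \<le> (272 / 100) * (3 * sqrt 2 - 3 :: real)"
      using q e_less_272 by (intro mult_right_mono) auto
    also have "\<dots> \<le> 2 + sqrt 2"
      using q' by simp
    finally show ?thesis by (simp add: algebra_simps)
  qed
  then show ?thesis
    using q by (simp add: field_simps)
qed

text \<open>The threshold equals 4 + 3 sqrt 2 - e, about 5.52.\<close>

lemma exp_plus_bound:
  "(11 / 2 :: real) \<le> (exp 1 + 2 - sqrt 2 * (exp 1 - 1)) / (sqrt 2 - 1)"
proof -
  have q: "(141 / 100 :: real) \<le> sqrt 2"
    by (rule real_le_rsqrt) (simp add: power2_eq_square)
  have q': "sqrt 2 \<le> (1415 / 1000 :: real)"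
    by (rule real_le_lsqrt) (simp_all add: power2_eq_square)
  have "(exp 1 + 11 / 2) * (sqrt 2 - 1) \<le> (272 / 100 + 11 / 2) * (sqrt 2 - 1 :: real)"
    using q e_less_272 by (intro mult_right_mono) auto
  also have "\<dots> \<le> 2 + sqrt 2"
    using q' by simp
  finally show ?thesis
    using q by (simp add: field_simps)
qed

text \<open>Jack's lemma.  By Schwarz, \<open>|w (z\<^sub>0 (1 + t u))| \<le> |1 + t u|\<close> for every direction \<open>u\<close>
  pointing into the disc.  Both sides agree at \<open>t = 0\<close>, so comparing the \<open>t\<close>-derivatives of the
  squares shows that multiplication by \<open>z\<^sub>0 w'(z\<^sub>0) / w(z\<^sub>0) - 1\<close> maps the half-plane \<open>Re u < 0\<close> into
  its closure; hence this number is a non-negative real.\<close>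

lemma Jack_lemma:
  fixes w :: "complex \<Rightarrow> complex"
  assumes hol: "w holomorphic_on ball 0 (norm z0)" and w0: "w 0 = 0"
    and lt: "\<And>z. norm z < norm z0 \<Longrightarrow> norm (w z) < 1"
    and der: "(w has_field_derivative d) (at z0)" and eq: "norm (w z0) = 1"
  obtains m :: real where "1 \<le> m" "z0 * d = of_real m * w z0"
proof -
  have z0: "z0 \<noteq> 0"
    using w0 eq by auto
  \<comment> \<open>Rescaling by \<open>z0\<close> moves the disc of radius |z0| to the unit disc,
    where Schwarz applies.\<close>
  have le: "norm (w (z0 * v)) \<le> norm v" if "norm v < 1" for v
  proof (rule Schwarz_Lemma(1)[where f = "\<lambda>v. w (z0 * v)"])
    have z0v: "norm (z0 * v) < norm z0" if "norm v < 1" for v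
      using that z0 by (simp add: norm_mult)
    show "(\<lambda>v. w (z0 * v)) holomorphic_on ball 0 1"
      using z0v by (intro holomorphic_on_compose_gen[OF _ hol, unfolded o_def] holomorphic_intros) auto
    show "norm (w (z0 * v)) < 1" if "norm v < 1" for v
      using z0v[OF that] by (rule lt)
  qed (use w0 that in auto)
  \<comment> \<open>As |w z0| = 1, the conjugate is the inverse, so h = z0 d / w z0 - 1.\<close>
  define h where "h = cnj (w z0) * (z0 * d) - 1"
  have neg: "Re (h * u) \<le> 0" if u: "Re u < 0" for u
  proof (rule ccontr)
    assume *: "\<not> Re (h * u) \<le> 0"
    define q where "q t = (norm (w (z0 * (1 + of_real t * u))))\<^sup>2 - (norm (1 + of_real t * u))\<^sup>2" for t
    have q0: "q 0 = 0"
      using eq by (simp add: q_def)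
    have lin: "((\<lambda>t. 1 + of_real t * u) has_vector_derivative u) (at (0::real))"
      by (auto intro!: derivative_eq_intros)
    have "((\<lambda>v. w (z0 * v)) has_field_derivative d * z0) (at (1 + of_real 0 * u))"
      using der by (auto intro!: derivative_eq_intros DERIV_chain2[where f = w])
    from field_vector_diff_chain_at[OF lin this]
    have wlin: "((\<lambda>t. w (z0 * (1 + of_real t * u))) has_vector_derivative (u * (d * z0))) (at (0::real))"
      by (simp add: o_def)
    have sq: "((\<lambda>t. (norm (g t))\<^sup>2) has_real_derivative 2 * Re (cnj (g 0) * g')) (at 0)"
      if "(g has_vector_derivative g') (at (0::real))" for g :: "real \<Rightarrow> complex" and g'
    proof -
      have R: "((\<lambda>t. Re (g t)) has_real_derivative Re g') (at 0)"
        and I: "((\<lambda>t. Im (g t)) has_real_derivative Im g') (at 0)"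
        using has_field_derivative_Re[OF that] has_field_derivative_Im[OF that] by auto
      show ?thesis
        unfolding cmod_power2 by (rule derivative_eq_intros R I refl)+ (simp add: algebra_simps)
    qed
    have "(q has_real_derivative 2 * Re (cnj (w z0) * (u * (d * z0))) - 2 * Re u) (at 0)"
      unfolding q_def using DERIV_diff[OF sq[OF wlin] sq[OF lin]] by simp
    then have der_q: "(q has_real_derivative 2 * Re (h * u)) (at 0)"
      by (simp add: h_def algebra_simps)
    obtain e where e: "0 < e" "\<And>t. 0 < t \<Longrightarrow> t < e \<Longrightarrow> 0 < q t"
      using DERIV_pos_inc_right[OF der_q] * q0 by auto
    have u0: "0 < (norm u)\<^sup>2"
      using u by auto
    \<comment> \<open>The first bound keeps t where q is positive; the second gives |1 + tu|^2 \<le>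
      1 + t Re u < 1, where Schwarz forces q t \<le> 0.\<close>
    define t where "t = min (e / 2) (- Re u / (norm u)\<^sup>2)"
    have t: "0 < t" "t < e" "t * (norm u)\<^sup>2 \<le> - Re u"
      using e(1) u u0 by (auto simp: t_def min_def field_simps)
    have "(norm (1 + of_real t * u))\<^sup>2 = 1 + t * (2 * Re u + t * (norm u)\<^sup>2)"
      by (simp add: cmod_power2) (simp add: power2_eq_square algebra_simps)
    also have "\<dots> < 1"
      using t u by (simp add: mult_pos_neg)
    finally have "norm (1 + of_real t * u) < 1"
      by (simp add: abs_square_less_1)
    from le[OF this] have "q t \<le> 0"
      by (simp add: q_def)
    with e(2)[OF t(1,2)] show False by simp
  qed
  have "0 \<le> Re h"
    using neg[of "-1"] by simp
  moreover have "Im h = 0"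
  proof (rule ccontr)
    assume "Im h \<noteq> 0"
    \<comment> \<open>The imaginary part of this u is chosen so that Re (h u) = 1.\<close>
    with neg[of "Complex (-1) (- (Re h + 1) / Im h)"] show False by simp
  qed
  moreover have "z0 * d = (h + 1) * w z0"
  proof -
    have "w z0 * cnj (w z0) = 1"
      using eq by (simp add: complex_norm_square[symmetric])
    then show ?thesis
      by (simp add: h_def algebra_simps)
  qed
  ultimately show thesis
    by (intro that[of "Re h + 1"]) (auto simp: complex_eq_iff)
qed


section \<open>The target disc and exit from the image of exp\<close>

text \<open>The left quantity is |4w - 2| / |2 - w|, and 4|2 - w|^2 - |4w - 2|^2 = 12(1 -
  |w|^2).\<close>

lemma norm_mobius_minus_two_less:
  fixes w :: complex
  assumes "norm w < 1"
  shows "norm ((2 + 2 * w) / (2 - w) - 2) < 2"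
proof -
  have w: "2 - w \<noteq> 0"
    using assms by auto
  have "(norm (4 * w - 2))\<^sup>2 = (2 * norm (2 - w))\<^sup>2 - 12 * (1 - (norm w)\<^sup>2)"
    unfolding power_mult_distrib cmod_power2 by simp (simp add: power2_eq_square algebra_simps)
  also have "\<dots> < (2 * norm (2 - w))\<^sup>2"
    using assms by (simp add: abs_square_less_1)
  finally have "norm (4 * w - 2) < 2 * norm (2 - w)"
    by (rule power2_less_imp_less) simp
  moreover have "(2 + 2 * w) / (2 - w) - 2 = (4 * w - 2) / (2 - w)"
    using w by (simp add: field_simps)
  ultimately show ?thesis
    using w by (simp add: norm_divide field_simps)
qed

text \<open>The closed unit disc lies in the strip |Im| < pi/2, which exp maps injectively into the
  right half-plane. Thus \<open>Ln\<close> inverts exp up to the boundary circle and is holomorphic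
  there.\<close>

lemma Ln_exp_norm_le_1:
  assumes "norm \<zeta> \<le> 1"
  shows "Ln (exp \<zeta>) = \<zeta>" and "exp \<zeta> \<notin> \<real>\<^sub>\<le>\<^sub>0"
proof -
  have Im: "\<bar>Im \<zeta>\<bar> \<le> 1"
    using assms abs_Im_le_cmod[of \<zeta>] by linarith
  then show Ln: "Ln (exp \<zeta>) = \<zeta>"
    using pi_gt3 by (intro Ln_exp) auto
  have "0 < cos (Im \<zeta>)"
    using Im pi_gt3 by (intro cos_gt_zero_pi) auto
  then show "exp \<zeta> \<notin> \<real>\<^sub>\<le>\<^sub>0"
    by (auto simp: complex_nonpos_Reals_iff Re_exp mult_le_0_iff not_le)
qed

text \<open>The points of modulus at most |z| that p sends outside S form a compact set;
  \<open>z0\<close> is one of least modulus.\<close>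

lemma first_exit:
  fixes p :: "complex \<Rightarrow> complex"
  assumes cont: "continuous_on (ball 0 1) p" and p0: "p 0 \<in> S" and S: "open S"
    and z: "norm z < 1" "p z \<notin> S"
  obtains z0 where "norm z0 < 1" "p z0 \<in> closure S - S" "\<And>z. norm z < norm z0 \<Longrightarrow> p z \<in> S"
proof -
  have cont': "continuous_on (cball 0 (norm z)) p"
    by (rule continuous_on_subset[OF cont]) (use z in auto)
  define A where "A = cball 0 (norm z) \<inter> p -` (- S)"
  have "closed A"
    unfolding A_def using S by (intro continuous_closed_preimage[OF cont']) auto
  then have "compact A"
    unfolding A_def by (simp add: compact_eq_bounded_closed bounded_Int)
  moreover have "z \<in> A"
    using z by (simp add: A_def)
  ultimately obtain z0 where z0: "z0 \<in> A" "\<And>y. y \<in> A \<Longrightarrow> norm z0 \<le> norm y"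
    using continuous_attains_inf[of A norm] by (auto intro: continuous_intros)
  have lt: "p y \<in> S" if "norm y < norm z0" for y
    using z0(1) z0(2)[of y] that by (auto simp: A_def)
  have norm_z0: "norm z0 < 1" and "p z0 \<notin> S"
    using z0(1) z by (auto simp: A_def)
  then have "z0 \<noteq> 0"
    using p0 by auto
  \<comment> \<open>Along the radius t \<open>z0\<close> with t increasing to 1, p takes values in
    S.\<close>
  have "p z0 \<in> closure S"
  proof (rule Lim_in_closed_set[OF closed_closure])
    have "((\<lambda>t. of_real t * z0) \<longlongrightarrow> of_real 1 * z0) (at_left (1::real))"
      by (intro tendsto_intros)
    moreover have "isCont p z0"
      using cont norm_z0 by (auto simp: continuous_on_eq_continuous_at)
    ultimately show "((\<lambda>t. p (of_real t * z0)) \<longlongrightarrow> p z0) (at_left (1::real))"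
      by (intro isCont_tendsto_compose[of z0 p]) auto
    have "eventually (\<lambda>t. t \<in> {0<..<1}) (at_left (1::real))"
      by (rule eventually_at_left_real) simp
    then show "eventually (\<lambda>t. p (of_real t * z0) \<in> closure S) (at_left (1::real))"
    proof eventually_elim
      case (elim t)
      then have "norm (of_real t * z0) < norm z0"
        using \<open>z0 \<noteq> 0\<close> by (simp add: norm_mult)
      from lt[OF this] show ?case
        using closure_subset by blast
    qed
  qed simp
  with norm_z0 \<open>p z0 \<notin> S\<close> lt show thesis
    by (intro that[of z0]) auto
qed

text \<open>If p stays in the image of the disc, \<open>Ln\<close> composed with p is the
  subordinating function. Otherwise Jack's lemma is applied to it at the first exit point.\<close>

lemma subordinate_exp_or_tangency:
  assumes hol: "p holomorphic_on ball 0 1" and p0: "p 0 = 1"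
  shows "p \<prec>\<^sub>s exp \<or>
    (\<exists>z0 \<zeta> m. norm z0 < 1 \<and> norm \<zeta> = 1 \<and> 1 \<le> m \<and> p z0 = exp \<zeta> \<and>
      z0 * deriv p z0 = of_real m * \<zeta> * exp \<zeta>)"
proof (cases "\<forall>z. norm z < 1 \<longrightarrow> p z \<in> exp ` ball 0 1")
  case True
  have 1: "norm (Ln (p z)) < 1" "p z \<notin> \<real>\<^sub>\<le>\<^sub>0" "exp (Ln (p z)) = p z" if z: "norm z < 1" for z
    using True[rule_format, OF z] by (auto simp: Ln_exp_norm_le_1)
  have "(\<lambda>z. Ln (p z)) holomorphic_on ball 0 1"
    using 1 by (intro holomorphic_on_Ln' hol) auto
  moreover have "exp holomorphic_on ball 0 1"
    by (intro holomorphic_intros)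
  ultimately have "p \<prec>\<^sub>s exp"
    unfolding subordinate_def using 1 p0 hol by (intro conjI exI[of _ "\<lambda>z. Ln (p z)"]) auto
  then show ?thesis ..
next
  case False
  then obtain z where z: "norm z < 1" "p z \<notin> exp ` ball 0 1"
    by auto
  let ?S = "exp ` ball 0 1 :: complex set"
  have "inj_on exp (ball 0 1 :: complex set)"
    by (rule inj_on_inverseI[of _ Ln]) (simp add: Ln_exp_norm_le_1)
  then have S: "open ?S"
    by (intro open_mapping_thm3) (auto intro: holomorphic_intros)
  have "p 0 \<in> ?S"
    unfolding p0 by (rule image_eqI[of _ _ 0]) auto
  from first_exit[OF holomorphic_on_imp_continuous_on[OF hol] this S z]
  obtain z0 where z0: "norm z0 < 1" "p z0 \<in> closure ?S - ?S"
    and lt: "\<And>z. norm z < norm z0 \<Longrightarrow> p z \<in> ?S"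
    by blast
  \<comment> \<open>The image of the closed disc is compact, so the exit value is exp \<zeta> with
    |\<zeta>| \<le> 1; lying outside \<open>?S\<close>, it forces |\<zeta>| = 1.\<close>
  have "closure ?S \<subseteq> exp ` cball 0 1"
    by (intro closure_minimal compact_imp_closed compact_continuous_image continuous_intros) auto
  with z0(2) obtain \<zeta> where \<zeta>: "p z0 = exp \<zeta>" "norm \<zeta> \<le> 1"
    by auto
  moreover have "\<zeta> \<notin> ball 0 1"
    using z0(2) \<zeta>(1) by blast
  ultimately have \<zeta>1: "norm \<zeta> = 1"
    by simp
  have lt': "norm (Ln (p z)) < 1" "p z \<notin> \<real>\<^sub>\<le>\<^sub>0" if "norm z < norm z0" for z
    using lt[OF that] by (auto simp: Ln_exp_norm_le_1)
  have "(p has_field_derivative deriv p z0) (at z0)"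
    using hol z0(1) by (intro holomorphic_derivI[of p "ball 0 1"]) auto
  then have der: "((\<lambda>z. Ln (p z)) has_field_derivative (deriv p z0 / p z0)) (at z0)"
    using \<zeta> Ln_exp_norm_le_1[of \<zeta>] by (auto intro!: derivative_eq_intros simp: field_simps)
  have "(\<lambda>z. Ln (p z)) holomorphic_on ball 0 (norm z0)"
    using lt' z0(1) by (intro holomorphic_on_Ln' holomorphic_on_subset[OF hol]) auto
  then obtain m :: real where m: "1 \<le> m" "z0 * (deriv p z0 / p z0) = of_real m * Ln (p z0)"
    by (rule Jack_lemma[OF _ _ _ der]) (use lt' p0 \<zeta> \<zeta>1 in \<open>auto simp: Ln_exp_norm_le_1\<close>)
  then have "z0 * deriv p z0 = of_real m * \<zeta> * exp \<zeta>"
    using \<zeta> by (simp add: Ln_exp_norm_le_1 field_simps)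
  then show ?thesis
    using z0(1) \<zeta>(1) \<zeta>1 m(1) by blast
qed

section \<open>The filled-in quotient and the zeros of f\<close>

text \<open>Away from 0 the quotient is f'(z) / (f(z)/z), and f(z)/z tends to f'(0).\<close>

lemma log_deriv_quot_at_0:
  assumes hol: "f holomorphic_on A" "open A" "0 \<in> A" and f: "f 0 = 0" "deriv f 0 \<noteq> 0"
  shows "log_deriv_quot f 0 = 1"
  unfolding log_deriv_quot_def
proof (rule remove_sings_eqI)
  have "(deriv f \<longlongrightarrow> deriv f 0) (at 0)"
    using holomorphic_deriv[OF hol(1,2)] hol(2,3)
    by (metis holomorphic_on_imp_continuous_on continuous_on_eq_continuous_at isContD)
  moreover have "((\<lambda>z. f z / z) \<longlongrightarrow> deriv f 0) (at 0)"
    using holomorphic_derivI[OF hol] f by (simp add: has_field_derivative_iff)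
  ultimately have "((\<lambda>z. deriv f z / (f z / z)) \<longlongrightarrow> deriv f 0 / deriv f 0) (at 0)"
    using f by (intro tendsto_divide)
  then show "((\<lambda>z. z * deriv f z / f z) \<longlongrightarrow> 1) (at 0)"
    using f by (simp add: mult.commute)
qed

text \<open>At an isolated zero of f, f'/f has a pole, and the nonzero factor z keeps it;
  \<open>remove_sings\<close> returns 0 at a pole. As exp never vanishes, a tangency point cannot be
  such a zero.\<close>

lemma log_deriv_quot_eq_0_at_zero:
  assumes hol: "f holomorphic_on A" "open A" "connected A" "z0 \<in> A"
    and f: "f z0 = 0" "z0 \<noteq> 0" "a \<in> A" "f a \<noteq> 0"
  shows "log_deriv_quot f z0 = 0"
proof -
  have an: "f analytic_on {z0}"
    using hol analytic_at by blast
  then obtain F where F: "(\<lambda>w. f (z0 + w)) has_laurent_expansion F"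
    using analytic_at_imp_has_fps_expansion has_laurent_expansion_fps by blast
  obtain r where r: "0 < r" "ball z0 r \<subseteq> A" "\<And>z. z \<in> ball z0 r - {z0} \<Longrightarrow> f z \<noteq> 0"
    by (rule isolated_zeros[OF hol f(1,3,4)], rule that)
  have "F \<noteq> 0"
  proof
    assume "F = 0"
    then have "eventually (\<lambda>w. f w = 0) (at z0)"
      using has_laurent_expansion_eventually_zero_iff[OF F] by simp
    moreover have "eventually (\<lambda>w. f w \<noteq> 0) (at z0)"
      using r(1,3) by (auto simp: eventually_at dist_commute)
    ultimately have "eventually (\<lambda>w. False) (at z0)"
      by eventually_elim simp
    then show False by simp
  qed
  moreover have "(f \<longlongrightarrow> 0) (at z0)"
    using analytic_at_imp_isCont[OF an] f(1) by (simp add: isCont_def)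
  ultimately have "is_pole (\<lambda>x. deriv f x / f x) z0"
    using is_pole_deriv_divide_iff[OF F] by blast
  then have "is_pole (\<lambda>x. x * (deriv f x / f x)) z0"
    using f by (intro is_pole_mult_analytic_nonzero1) auto
  then show ?thesis
    by (simp add: log_deriv_quot_def)
qed

text \<open>This restates tangency of p in terms of f through z p'/p = 1 - p + z f''/f', at points
  where every denominator is nonzero.\<close>

lemma starlike_exp_criterion:
  assumes f: "f \<in> normalized_analytic" and hol: "log_deriv_quot f holomorphic_on unit_disc"
    and no_tangency: "\<And>z \<zeta> m. \<lbrakk>norm z < 1; f z \<noteq> 0; deriv f z \<noteq> 0; norm \<zeta> = 1; 1 \<le> m;
      z * deriv f z / f z = exp \<zeta>;
      1 - z * deriv f z / f z + z * deriv (deriv f) z / deriv f z = of_real m * \<zeta>\<rbrakk> \<Longrightarrow> False"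
  shows "f \<in> starlike_exp"
proof -
  let ?p = "log_deriv_quot f"
  have fhol: "f holomorphic_on ball 0 1" and f0: "f 0 = 0" and f'0: "deriv f 0 = 1"
    using f by (auto simp: normalized_analytic_def)
  have fhol': "deriv f holomorphic_on ball 0 1"
    using fhol by (rule holomorphic_deriv) simp
  have p0: "?p 0 = 1"
    using log_deriv_quot_at_0[OF fhol] f0 f'0 by simp
  have False if z0: "norm z0 < 1" and \<zeta>: "norm \<zeta> = 1" and m: "1 \<le> m" and p: "?p z0 = exp \<zeta>"
    and p': "z0 * deriv ?p z0 = of_real m * \<zeta> * exp \<zeta>" for z0 \<zeta> and m :: real
  proof -
    have "z0 \<noteq> 0"
      using p' \<zeta> m by auto
    obtain a where a: "norm a < 1" "f a \<noteq> 0"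
    proof -
      have "\<exists>a\<in>ball 0 1. f a \<noteq> 0"
      proof (rule ccontr)
        assume "\<not> (\<exists>a\<in>ball 0 1. f a \<noteq> 0)"
        then have "deriv f 0 = deriv (\<lambda>_. 0) 0"
          by (intro deriv_cong_ev eventually_nhds_in_open[of "ball 0 1", THEN eventually_mono]) auto
        then show False
          using f'0 by simp
      qed
      then show thesis
        using that by auto
    qed
    have fz0: "f z0 \<noteq> 0"
      using log_deriv_quot_eq_0_at_zero[OF fhol _ _ _ _ \<open>z0 \<noteq> 0\<close>, of a] a z0 p by auto
    have p_eq: "?p z = z * deriv f z / f z" if z: "norm z < 1" "f z \<noteq> 0" for z
    proof -
      have "f analytic_on {z}" "deriv f analytic_on {z}"
        using fhol fhol' z by (auto simp: analytic_at intro!: exI[of _ "ball 0 1"])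
      then show ?thesis
        unfolding log_deriv_quot_def using z
        by (intro remove_sings_at_analytic) (auto intro!: analytic_intros)
    qed
    have f'z0: "deriv f z0 \<noteq> 0"
      using p p_eq[OF z0 fz0] by auto
    \<comment> \<open>Differentiating p needs agreement with the plain quotient near
      \<open>z0\<close>, not only at it.\<close>
    have "open (ball 0 1 \<inter> f -` (- {0}))"
      using fhol by (intro continuous_open_preimage holomorphic_on_imp_continuous_on) auto
    then have ev: "eventually (\<lambda>z. ?p z = z * deriv f z / f z) (nhds z0)"
      using z0 fz0 by (intro eventually_mono[OF eventually_nhds_in_open[OF \<open>open _\<close>]] p_eq) auto
    have d1: "(f has_field_derivative deriv f z0) (at z0)"
      and d2: "(deriv f has_field_derivative deriv (deriv f) z0) (at z0)"
      using fhol fhol' z0 by (auto intro!: holomorphic_derivI[of _ "ball 0 1"])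
    have "((\<lambda>z. z * deriv f z / f z) has_field_derivative
        ((deriv f z0 + z0 * deriv (deriv f) z0) * f z0 - z0 * deriv f z0 * deriv f z0) / (f z0 * f z0)) (at z0)"
      by (rule derivative_eq_intros d1 d2 refl fz0)+ (simp add: algebra_simps)
    then have deriv_p: "deriv ?p z0 =
        ((deriv f z0 + z0 * deriv (deriv f) z0) * f z0 - z0 * deriv f z0 * deriv f z0) / (f z0 * f z0)"
      using deriv_cong_ev[OF ev refl] by (simp add: DERIV_imp_deriv)
    have "z0 * deriv ?p z0 = (z0 * deriv f z0 / f z0) *
        (1 - z0 * deriv f z0 / f z0 + z0 * deriv (deriv f) z0 / deriv f z0)"
      unfolding deriv_p using fz0 f'z0 by (simp add: field_simps)
    then have "exp \<zeta> * (1 - z0 * deriv f z0 / f z0 + z0 * deriv (deriv f) z0 / deriv f z0) = exp \<zeta> * (of_real m * \<zeta>)"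
      unfolding p' p_eq[OF z0 fz0, symmetric] p by (simp only: ac_simps)
    then have "1 - z0 * deriv f z0 / f z0 + z0 * deriv (deriv f) z0 / deriv f z0 = of_real m * \<zeta>"
      by (simp only: mult_left_cancel exp_not_eq_zero not_False_eq_True)
    then show False
      using no_tangency[OF z0 fz0 f'z0 \<zeta> m] p p_eq[OF z0 fz0] by simp
  qed
  then show ?thesis
    using subordinate_exp_or_tangency[OF hol p0] f unfolding starlike_exp_def by blast
qed

theorem mainTheorem9:
  fixes f :: "complex \<Rightarrow> complex" and \<beta> :: real
  assumes "f \<in> normalized_analytic"
    and "log_deriv_quot f holomorphic_on unit_disc"
    and "(remove_sings (\<lambda>z. z * deriv f z / f z
             + of_real \<beta> * (z * deriv f z / f z)
               * (1 - z * deriv f z / f z + z * deriv (deriv f) z / deriv f z))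
           \<prec>\<^sub>s (\<lambda>z. (2 + 2 * z) / (2 - z))
          \<and> \<beta> \<ge> (exp 1 + 2 - sqrt 2 * (exp 1 - 1)) / (exp 1 * (sqrt 2 - 1)))
       \<or> (remove_sings (\<lambda>z. z * deriv f z / f z
             + of_real \<beta> * (1 - z * deriv f z / f z + z * deriv (deriv f) z / deriv f z))
           \<prec>\<^sub>s (\<lambda>z. (2 + 2 * z) / (2 - z))
          \<and> \<beta> \<ge> (exp 1 + 2 - sqrt 2 * (exp 1 - 1)) / (sqrt 2 - 1))"
  shows "f \<in> starlike_exp"
proof (rule starlike_exp_criterion[OF assms(1,2)])
  fix z \<zeta> :: complex and m :: real
  assume z: "norm z < 1" and fz: "f z \<noteq> 0" and f'z: "deriv f z \<noteq> 0" and \<zeta>: "norm \<zeta> = 1" and m: "1 \<le> m"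
    and p: "z * deriv f z / f z = exp \<zeta>"
    and J: "1 - z * deriv f z / f z + z * deriv (deriv f) z / deriv f z = of_real m * \<zeta>"
  have fhol: "f holomorphic_on ball 0 1"
    using assms(1) by (simp add: normalized_analytic_def)
  have an [analytic_intros]: "f analytic_on {z}" "deriv f analytic_on {z}" "deriv (deriv f) analytic_on {z}"
    using fhol z by (auto simp: analytic_at intro!: exI[of _ "ball 0 1"] holomorphic_deriv)
  have less: "norm (F z - 2) < 2" if "F \<prec>\<^sub>s (\<lambda>z. (2 + 2 * z) / (2 - z))" for F
    using that z norm_mobius_minus_two_less by (auto simp: subordinate_def)
  \<comment> \<open>The circle estimates are used with k = \<beta> m, and m \<ge> 1 preserves the
    lower bound on \<beta>.\<close>
  have k: "c \<le> \<beta> * m" if "c \<le> \<beta>" "0 \<le> c" for c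
    using mult_mono[OF that(1) m] that by simp
  from assms(3) show False
  proof (elim disjE conjE)
    let ?F = "\<lambda>z. z * deriv f z / f z + of_real \<beta> * (z * deriv f z / f z)
               * (1 - z * deriv f z / f z + z * deriv (deriv f) z / deriv f z)"
    assume sub: "remove_sings ?F \<prec>\<^sub>s (\<lambda>z. (2 + 2 * z) / (2 - z))"
      and \<beta>: "\<beta> \<ge> (exp 1 + 2 - sqrt 2 * (exp 1 - 1)) / (exp 1 * (sqrt 2 - 1))"
    \<comment> \<open>Both f and f' are nonzero at z, so the expression is analytic there and
      filling in changes nothing.\<close>
    have "remove_sings ?F z = ?F z"
      using fz f'z by (intro remove_sings_at_analytic analytic_intros) auto
    also have "\<dots> = exp \<zeta> * (1 + of_real (\<beta> * m) * \<zeta>)" (is "_ = ?E")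
      unfolding J unfolding p by (simp add: algebra_simps)
    finally have "norm (?E - 2) < 2"
      using less[OF sub] by (simp only:)
    moreover have "2 \<le> norm (?E - 2)"
      by (intro norm_exp_mult_one_plus_minus_two_ge[OF \<zeta>] k order_trans[OF two_le_exp_mult_bound \<beta>]) simp
    ultimately show False by linarith
  next
    let ?F = "\<lambda>z. z * deriv f z / f z
             + of_real \<beta> * (1 - z * deriv f z / f z + z * deriv (deriv f) z / deriv f z)"
    assume sub: "remove_sings ?F \<prec>\<^sub>s (\<lambda>z. (2 + 2 * z) / (2 - z))"
      and \<beta>: "\<beta> \<ge> (exp 1 + 2 - sqrt 2 * (exp 1 - 1)) / (sqrt 2 - 1)"
    have "remove_sings ?F z = ?F z"
      using fz f'z by (intro remove_sings_at_analytic analytic_intros) auto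
    also have "\<dots> = exp \<zeta> + of_real (\<beta> * m) * \<zeta>" (is "_ = ?E")
      unfolding J unfolding p by (simp add: algebra_simps)
    finally have "norm (?E - 2) < 2"
      using less[OF sub] by (simp only:)
    moreover have "2 \<le> norm (?E - 2)"
      by (intro norm_exp_plus_minus_two_ge[OF \<zeta>] k order_trans[OF exp_plus_bound \<beta>]) simp
    ultimately show False by linarith
  qed
qed

end
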